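(* Consider the rotating ($a\neq0$) G\"urses-G\"ursey metric $$ds^2=-\Bigl(1-\frac{2M(r)r}{\Sigma}\Bigr)dt^2-\frac{4aM(r)r\sin^2\theta}{\Sigma}\,dt\,d\phi+\frac{\Sigma}{\Delta}dr^2+\Sigma\, d\theta^2+\Bigl(r^2+a^2+\frac{2a^2M(r)r\sin^2\theta}{\Sigma}\Bigr)\sin^2\theta\, d\phi^2,$$ $\Sigma=r^2+a^2\cos^2\theta$, $\Delta(r)=r^2+a^2-2rM(r)$, extended through $r=0$ (with $\theta\ne\pi/2$) to negative values of $r$. The rotating Hayward spacetime, $M(r)=\dfrac{mr^3}{r^3+2ml^2}$, and the rotating Fan-Wang spacetime, $M(r)=\dfrac{mr^3}{(r+l)^3}$, with $m\neq0$ and $l>0$, contain a scalar polynomial curvature singularity in the region with negative $r$. The Ricci scalar of the rotating Fan-Wang spacetime is $$R=\frac{24ml^2r^2}{(r+l)^5(r^2+a^2\cos^2\theta)},$$ which blows up at $r=-l\,(<0)$. The Ricci scalar of the rotating Hayward spacetime is $$R=-\frac{24m^2l^2r^2(r^3-4ml^2)}{(r^3+2ml^2)^3(r^2+a^2\cos^2\theta)},$$ which blows up at $r=-\epsilon(2|m|l^2)^{1/3}$, where $\epsilon=\pm1$ is the sign of $m$.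
   Context: $m$, $l$ and $a$ are real constants. Signature $(-,+,+,+)$; curvature conventions $[\nabla_\rho,\nabla_\sigma]V^\mu=R^\mu{}_{\nu\rho\sigma}V^\nu$, $R_{\mu\nu}=R^\rho{}_{\mu\rho\nu}$. A scalar polynomial curvature singularity is a locus at which some scalar polynomial in the metric and the Riemann tensor diverges.
   Formalization: For the rotating Hayward spacetime, "in the region with negative r" is asserted only for m>0; for m<0 the stated radius -ε(2|m|l²)^{1/3} is positive and nothing diverges at negative r, so there the singularity is asserted at that positive radius. *)

theory Defs
  imports "HOL-Analysis.Analysis" "HOL-Combinatorics.Permutations"
begin

section \<open>Curvature of a metric given in a coordinate chart\<close>

text \<open>A metric is given by its component matrix as a function of the coordinates.
  It is only meaningful on an open chart domain; all operators below are local.\<close>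

type_synonym 'n metric = "real^'n \<Rightarrow> real^'n^'n"

definition partial :: "'n::finite \<Rightarrow> (real^'n \<Rightarrow> real) \<Rightarrow> real^'n \<Rightarrow> real" where
  "partial i f x = deriv (\<lambda>s. f (x + s *\<^sub>R axis i 1)) 0"

definition christoffel :: "'n::finite metric \<Rightarrow> 'n \<Rightarrow> 'n \<Rightarrow> 'n \<Rightarrow> real^'n \<Rightarrow> real" where
  "christoffel g \<mu> \<nu> \<rho> x = (1/2) * (\<Sum>\<kappa>\<in>UNIV. matrix_inv (g x) $ \<mu> $ \<kappa> *
     (partial \<nu> (\<lambda>y. g y $ \<rho> $ \<kappa>) x + partial \<rho> (\<lambda>y. g y $ \<nu> $ \<kappa>) x
        - partial \<kappa> (\<lambda>y. g y $ \<nu> $ \<rho>) x))"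

text \<open>\<open>riemann g \<mu> \<nu> \<rho> \<sigma>\<close> is $R^\mu{}_{\nu\rho\sigma}$, with the sign fixed by
  $[\nabla_\rho,\nabla_\sigma]V^\mu=R^\mu{}_{\nu\rho\sigma}V^\nu$.\<close>

definition riemann :: "'n::finite metric \<Rightarrow> 'n \<Rightarrow> 'n \<Rightarrow> 'n \<Rightarrow> 'n \<Rightarrow> real^'n \<Rightarrow> real" where
  "riemann g \<mu> \<nu> \<rho> \<sigma> x =
     partial \<rho> (christoffel g \<mu> \<sigma> \<nu>) x - partial \<sigma> (christoffel g \<mu> \<rho> \<nu>) x
     + (\<Sum>\<kappa>\<in>UNIV. christoffel g \<mu> \<rho> \<kappa> x * christoffel g \<kappa> \<sigma> \<nu> x
                   - christoffel g \<mu> \<sigma> \<kappa> x * christoffel g \<kappa> \<rho> \<nu> x)"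

definition ricci :: "'n::finite metric \<Rightarrow> 'n \<Rightarrow> 'n \<Rightarrow> real^'n \<Rightarrow> real" where
  "ricci g \<mu> \<nu> x = (\<Sum>\<rho>\<in>UNIV. riemann g \<rho> \<mu> \<rho> \<nu> x)"

definition ricci_scalar :: "'n::finite metric \<Rightarrow> real^'n \<Rightarrow> real" where
  "ricci_scalar g x = (\<Sum>\<mu>\<in>UNIV. \<Sum>\<nu>\<in>UNIV. matrix_inv (g x) $ \<mu> $ \<nu> * ricci g \<mu> \<nu> x)"

definition riemann_low :: "'n::finite metric \<Rightarrow> 'n \<Rightarrow> 'n \<Rightarrow> 'n \<Rightarrow> 'n \<Rightarrow> real^'n \<Rightarrow> real" where
  "riemann_low g \<mu> \<nu> \<rho> \<sigma> x = (\<Sum>\<kappa>\<in>UNIV. g x $ \<mu> $ \<kappa> * riemann g \<kappa> \<nu> \<rho> \<sigma> x)"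


section \<open>Scalar polynomials and singularities\<close>

text \<open>The product of \<open>n\<close> copies of the Riemann tensor has \<open>4 * n\<close> lower index slots. A
  complete contraction pairs them off with \<open>2 * n\<close> inverse metrics; the pairing is encoded by
  a permutation \<open>\<pi>\<close> of the slots, slot \<open>\<pi> (2 * j)\<close> being contracted with slot
  \<open>\<pi> (2 * j + 1)\<close>. The function \<open>i\<close> assigns an index value to every slot.\<close>

definition complete_contraction ::
    "'n::finite metric \<Rightarrow> nat \<Rightarrow> (nat \<Rightarrow> nat) \<Rightarrow> real^'n \<Rightarrow> real" where
  "complete_contraction g n \<pi> x =
     (\<Sum>i \<in> {..<4*n} \<rightarrow>\<^sub>E UNIV.
        (\<Prod>k<n. riemann_low g (i (4*k)) (i (4*k+1)) (i (4*k+2)) (i (4*k+3)) x) *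
        (\<Prod>j<2*n. matrix_inv (g x) $ i (\<pi> (2*j)) $ i (\<pi> (2*j+1))))"

text \<open>Further factors of the metric contribute nothing new: contracting them only raises or
  lowers indices or yields the dimension. The case \<open>n = 0\<close> gives the constants.\<close>

inductive_set scalar_polynomials :: "'n::finite metric \<Rightarrow> (real^'n \<Rightarrow> real) set"
  for g :: "'n::finite metric" where
  contraction: "\<pi> permutes {..<4*n} \<Longrightarrow> complete_contraction g n \<pi> \<in> scalar_polynomials g"
| scale: "S \<in> scalar_polynomials g \<Longrightarrow> (\<lambda>x. c * S x) \<in> scalar_polynomials g"
| add: "S \<in> scalar_polynomials g \<Longrightarrow> T \<in> scalar_polynomials g
    \<Longrightarrow> (\<lambda>x. S x + T x) \<in> scalar_polynomials g"

text \<open>The point \<open>p\<close> is in general not in the chart domain \<open>U\<close>; it must be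
  approachable from within \<open>U\<close>, as otherwise the limit would be vacuous.\<close>

definition blows_up_at :: "(real^'n \<Rightarrow> real) \<Rightarrow> (real^'n) set \<Rightarrow> real^'n \<Rightarrow> bool" where
  "blows_up_at S U p \<longleftrightarrow> p islimpt U \<and> filterlim (\<lambda>x. \<bar>S x\<bar>) at_top (at p within U)"

definition scalar_polynomial_singularity ::
    "'n::finite metric \<Rightarrow> (real^'n) set \<Rightarrow> (real^'n) set \<Rightarrow> bool" where
  "scalar_polynomial_singularity g U L \<longleftrightarrow>
     L \<noteq> {} \<and> (\<exists>S\<in>scalar_polynomials g. \<forall>p\<in>L. blows_up_at S U p)"


section \<open>The Guerses-Guersey metric\<close>

text \<open>Coordinates $(t,r,\theta,\phi)$ are the components \<open>x$1\<close>, \<open>x$2\<close>, \<open>x$3\<close>, \<open>x$4\<close>.\<close>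

definition gg_Sigma :: "real \<Rightarrow> real \<Rightarrow> real \<Rightarrow> real" where
  "gg_Sigma a r \<theta> = r^2 + a^2 * (cos \<theta>)^2"

definition gg_Delta :: "(real \<Rightarrow> real) \<Rightarrow> real \<Rightarrow> real \<Rightarrow> real" where
  "gg_Delta M a r = r^2 + a^2 - 2 * r * M r"

text \<open>The off-diagonal entry is half the coefficient of $dt\,d\phi$.\<close>

definition gg_metric :: "(real \<Rightarrow> real) \<Rightarrow> real \<Rightarrow> 4 metric" where
  "gg_metric M a x =
    (let r = x$2; \<theta> = x$3; \<Sigma> = gg_Sigma a r \<theta>; \<Delta> = gg_Delta M a r;
         g_tp = - (2 * a * M r * r * (sin \<theta>)^2) / \<Sigma>
     in vector
      [vector [- (1 - 2 * M r * r / \<Sigma>), 0, 0, g_tp],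
       vector [0, \<Sigma> / \<Delta>, 0, 0],
       vector [0, 0, \<Sigma>, 0],
       vector [g_tp, 0, 0,
               (r^2 + a^2 + 2 * a^2 * M r * r * (sin \<theta>)^2 / \<Sigma>) * (sin \<theta>)^2]])"

text \<open>The part of the coordinate domain with radii in \<open>I\<close>, where \<open>I\<close> is to be a set of
  radii, of either sign, at which \<open>M\<close> is regular. For \<open>a \<noteq> 0\<close>, the condition
  \<open>\<Sigma> \<noteq> 0\<close> excludes exactly $r=0$, $\theta=\pi/2$.\<close>

definition gg_chart :: "(real \<Rightarrow> real) \<Rightarrow> real \<Rightarrow> real set \<Rightarrow> (real^4) set" where
  "gg_chart M a I = {x. x$2 \<in> I \<and> 0 < x$3 \<and> x$3 < pi \<and>
     gg_Sigma a (x$2) (x$3) \<noteq> 0 \<and> gg_Delta M a (x$2) \<noteq> 0}"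

definition radius_locus :: "real \<Rightarrow> (real^4) set" where
  "radius_locus r0 = {x. x$2 = r0 \<and> 0 \<le> x$3 \<and> x$3 \<le> pi}"

definition hayward_mass :: "real \<Rightarrow> real \<Rightarrow> real \<Rightarrow> real" where
  "hayward_mass m l r = m * r^3 / (r^3 + 2 * m * l^2)"

definition hayward_radii :: "real \<Rightarrow> real \<Rightarrow> real set" where
  "hayward_radii m l = {r. r^3 + 2 * m * l^2 \<noteq> 0}"

definition fan_wang_mass :: "real \<Rightarrow> real \<Rightarrow> real \<Rightarrow> real" where
  "fan_wang_mass m l r = m * r^3 / (r + l)^3"

definition fan_wang_radii :: "real \<Rightarrow> real set" where
  "fan_wang_radii l = {r. r + l \<noteq> 0}"

text \<open>Continuation through $r=0$ reaches only the regular radii connected to \<open>0\<close>.\<close>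

definition extended_radii :: "real set \<Rightarrow> real set" where
  "extended_radii I = connected_component_set I 0"

end

(* The metric depends on M only through F(r) = 2 r M(r). With
     L2 = (r F' - F) / Sigma^2   and   L1 = F'' / (2 Sigma) - L2
   the Ricci tensor is
     - L1 (Delta/Sigma) k k + L2 (sin^2/Sigma) n n + L1 (Sigma/Delta) dr dr + L2 Sigma dtheta dtheta,
   where k = dt - a sin^2 dphi and n = (r^2 + a^2) dphi - a dt, so that R = 2 L1 + 2 L2 = F'' / Sigma.
   For both mass functions F and F'' have a pole at the radius r0 in question, while Sigma tends to a
   positive limit there; since F is unbounded, Delta does not vanish near r0, and the segment from r0
   to 0 approaches every point of the locus from within the extended chart. *)

theory Submission
  imports Defs
begin

section \<open>Coordinate derivatives and matrix inverses\<close>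

text \<open>The quantities L1 and L2 are eigenvalues. The metric itself equals -(Delta/Sigma) k k +
  (sin^2/Sigma) n n + (Sigma/Delta) dr dr + Sigma dtheta dtheta, so the Ricci tensor is diagonal in
  the same frame, with L1 on k and dr and L2 on n and dtheta; this explains the trace. The main
  obstacle is the size of the component computation, where r, theta, F, Sigma and Delta are tied by
  relations. Where possible the dependent quantities are eliminated, which leaves identities between
  rational functions; for the Ricci tensor the reciprocals become variables of their own and each
  identity is an explicit combination of the relations. Two points of the statement also need work:
  the Ricci scalar must be exhibited as a complete contraction given by a permutation of slots, and
  the locus contains the axis theta = 0, pi, which the chart omits, so curves approaching it must
  leave the axis.\<close>

lemma vector_4:
  "(vector [w, x, y, z] :: 'a::zero^4) $ 1 = w"
  "(vector [w, x, y, z] :: 'a::zero^4) $ 2 = x"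
  "(vector [w, x, y, z] :: 'a::zero^4) $ 3 = y"
  "(vector [w, x, y, z] :: 'a::zero^4) $ 4 = z"
  unfolding vector_def by simp_all

lemma matrix_inv_eqI:
  fixes A B :: "real^'n^'n"
  assumes "A ** B = mat 1"
  shows "matrix_inv A = B"
proof -
  have "B ** A = mat 1" using assms matrix_left_right_inverse by blast
  then have "\<exists>C. A ** C = mat 1 \<and> C ** A = mat 1" using assms by blast
  then have "A ** matrix_inv A = mat 1 \<and> matrix_inv A ** A = mat 1"
    unfolding matrix_inv_def by (rule someI_ex)
  then show ?thesis
    by (metis assms matrix_mul_assoc matrix_mul_lid matrix_mul_rid)
qed

text \<open>A derivative depends only on the germ of the function, so a closed form valid on an open
  chart suffices. This matters because the formulas for the Christoffel symbols fail to make sense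
  where a denominator vanishes.\<close>

lemma partial_eqI:
  assumes "open U" "x \<in> U" "\<And>y. y \<in> U \<Longrightarrow> f y = h y"
    and "((\<lambda>s. h (x + s *\<^sub>R axis i 1)) has_real_derivative D) (at 0)"
  shows "partial i f x = D"
proof -
  have "isCont (\<lambda>s. x + s *\<^sub>R axis i (1::real)) 0"
    by (intro continuous_intros)
  then have "\<forall>\<^sub>F s in nhds 0. x + s *\<^sub>R axis i (1::real) \<in> U"
    unfolding continuous_at tendsto_def
    using assms(1,2) by (auto simp: eventually_nhds_conv_at)
  then have "\<forall>\<^sub>F s in nhds 0. f (x + s *\<^sub>R axis i 1) = h (x + s *\<^sub>R axis i 1)"
    by (rule eventually_mono) (use assms(3) in auto)
  then have "((\<lambda>s. f (x + s *\<^sub>R axis i 1)) has_real_derivative D) (at 0)"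
    using assms(4) by (subst DERIV_cong_ev[OF refl _ refl])
  then show ?thesis
    unfolding partial_def by (rule DERIV_imp_deriv)
qed

context
  fixes f :: "real^4 \<Rightarrow> real" and H :: "real \<Rightarrow> real \<Rightarrow> real" and U x
  assumes U: "open U" "x \<in> U" and H: "\<And>y. y \<in> U \<Longrightarrow> f y = H (y$2) (y$3)"
begin

lemma partial_1_eqI: "partial 1 f x = 0"
  by (rule partial_eqI[OF U H]) (auto simp: axis_def)

lemma partial_4_eqI: "partial 4 f x = 0"
  by (rule partial_eqI[OF U H]) (auto simp: axis_def)

lemma partial_2_eqI:
  assumes "((\<lambda>r. H r (x$3)) has_real_derivative D) (at (x$2))"
  shows "partial 2 f x = D"
  using assms DERIV_shift[of "\<lambda>r. H r (x$3)" D 0 "x$2"]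
  by (intro partial_eqI[OF U H]) (auto simp: axis_def add.commute)

lemma partial_3_eqI:
  assumes "((\<lambda>\<theta>. H (x$2) \<theta>) has_real_derivative D) (at (x$3))"
  shows "partial 3 f x = D"
  using assms DERIV_shift[of "\<lambda>\<theta>. H (x$2) \<theta>" D 0 "x$3"]
  by (intro partial_eqI[OF U H]) (auto simp: axis_def add.commute)

end

section \<open>Christoffel symbols of the Guerses-Guersey metric\<close>

locale gurses_gursey =
  fixes M F F1 F2 :: "real \<Rightarrow> real" and a :: real and I :: "real set"
  assumes open_I: "open I"
    and F_eq: "\<And>r. F r = 2 * r * M r"
    and F_deriv: "\<And>r. r \<in> I \<Longrightarrow> (F has_real_derivative F1 r) (at r)"
    and F1_deriv: "\<And>r. r \<in> I \<Longrightarrow> (F1 has_real_derivative F2 r) (at r)"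
begin

abbreviation "S \<equiv> gg_Sigma a"
definition "D r = r^2 + a^2 - F r"
abbreviation "U \<equiv> gg_chart M a I"
abbreviation "g \<equiv> gg_metric M a"

lemma Delta_eq: "gg_Delta M a r = D r"
  by (simp add: gg_Delta_def D_def F_eq)

definition metric_rt :: "real \<Rightarrow> real \<Rightarrow> real^4^4" where
  "metric_rt r \<theta> = vector
    [vector [- 1 + F r / S r \<theta>, 0, 0, - a * F r * (sin \<theta>)^2 / S r \<theta>],
     vector [0, S r \<theta> / D r, 0, 0],
     vector [0, 0, S r \<theta>, 0],
     vector [- a * F r * (sin \<theta>)^2 / S r \<theta>, 0, 0,
       (r^2 + a^2 + a^2 * F r * (sin \<theta>)^2 / S r \<theta>) * (sin \<theta>)^2]]"

text \<open>The (t, phi) block of the metric has determinant -Delta sin^2; this is the origin of the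
  denominators in the corner entries.\<close>

definition inverse_rt :: "real \<Rightarrow> real \<Rightarrow> real^4^4" where
  "inverse_rt r \<theta> = vector
    [vector [- (r^2 + a^2 + a^2 * F r * (sin \<theta>)^2 / S r \<theta>) / D r, 0, 0, - a * F r / (S r \<theta> * D r)],
     vector [0, D r / S r \<theta>, 0, 0],
     vector [0, 0, 1 / S r \<theta>, 0],
     vector [- a * F r / (S r \<theta> * D r), 0, 0, (1 - F r / S r \<theta>) / (D r * (sin \<theta>)^2)]]"

lemma metric_eq: "g x = metric_rt (x$2) (x$3)"
  by (simp add: gg_metric_def metric_rt_def Let_def Delta_eq vec_eq_iff forall_4 vector_4 F_eq ac_simps)

lemma chart_nonzero:
  assumes "x \<in> U"
  shows "S (x$2) (x$3) \<noteq> 0" "D (x$2) \<noteq> 0" "sin (x$3) \<noteq> 0" "x$2 \<in> I"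
  using assms sin_gt_zero[of "x$3"] by (auto simp: gg_chart_def Delta_eq)

lemma inverse_rt:
  assumes nz: "S r \<theta> \<noteq> 0" "D r \<noteq> 0" "sin \<theta> \<noteq> 0"
  shows "metric_rt r \<theta> ** inverse_rt r \<theta> = mat 1"
proof -
  define \<Sigma> \<Delta> s where "\<Sigma> = S r \<theta>" and "\<Delta> = D r" and "s = sin \<theta>"
  \<comment> \<open>Rewriting with this equation and the next one leaves only \<Sigma>, \<Delta>,
    \<open>s\<close> and \<open>a\<close>, so that the claim becomes an identity of rational
    functions in independent variables.\<close>
  have r: "r^2 + a^2 = \<Sigma> + a^2 * s^2"
    by (simp add: \<Sigma>_def s_def gg_Sigma_def cos_squared_eq algebra_simps)
  have F: "F r = \<Sigma> + a^2 * s^2 - \<Delta>"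
    using r by (simp add: \<Delta>_def D_def)
  have "\<Sigma> \<noteq> 0" "\<Delta> \<noteq> 0" "s \<noteq> 0" using nz by (auto simp: \<Sigma>_def \<Delta>_def s_def)
  then show ?thesis
    unfolding metric_rt_def inverse_rt_def \<Sigma>_def[symmetric] \<Delta>_def[symmetric] s_def[symmetric] r F
    by (simp add: matrix_matrix_mult_def vec_eq_iff forall_4 vector_4 sum_4 mat_def)
       (simp add: field_simps; intro conjI; algebra?)
qed

lemma open_chart: "open U"
proof -
  have "continuous_on I F"
    using F_deriv open_I by (auto intro!: continuous_at_imp_continuous_on DERIV_isCont)
  then have "continuous_on {x::real^4. x$2 \<in> I} (\<lambda>x. F (x$2))"
    by (rule continuous_on_compose2) (auto intro!: continuous_intros)
  then have *: "continuous_on {x::real^4. x$2 \<in> I} (\<lambda>x. gg_Delta M a (x$2))"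
    unfolding Delta_eq D_def by (intro continuous_intros)
  have "open ((\<lambda>x::real^4. x$2) -` I)"
    by (rule open_vimage[OF open_I]) (intro continuous_intros)
  then have o: "open {x::real^4. x$2 \<in> I}" by (simp add: vimage_def)
  \<comment> \<open>Delta is known to be continuous only over \<open>I\<close>; preimages are
    therefore taken within the open slab of radii in \<open>I\<close>.\<close>
  have "open ((\<lambda>x::real^4. gg_Delta M a (x$2)) -` (-{0}) \<inter> {x. x$2 \<in> I})"
    using * o by (subst (asm) continuous_on_open_vimage) auto
  moreover have "open {x::real^4. 0 < x$3 \<and> x$3 < pi \<and> S (x$2) (x$3) \<noteq> 0}"
    unfolding gg_Sigma_def
    by (intro open_Collect_conj open_Collect_less open_Collect_neq continuous_intros)
  ultimately have "open (((\<lambda>x::real^4. gg_Delta M a (x$2)) -` (-{0}) \<inter> {x. x$2 \<in> I}) \<inter>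
       {x::real^4. 0 < x$3 \<and> x$3 < pi \<and> S (x$2) (x$3) \<noteq> 0})" by (rule open_Int)
  also have "\<dots> = U" by (auto simp: gg_chart_def)
  finally show ?thesis .
qed

section \<open>Derivatives of the metric components and closed forms of the Christoffel
  symbols\<close>

lemma S_deriv_r: "((\<lambda>r. S r \<theta>) has_real_derivative 2 * r) (at r)"
  unfolding gg_Sigma_def by (auto intro!: derivative_eq_intros)

lemma S_deriv_th: "((\<lambda>\<theta>. S r \<theta>) has_real_derivative - 2 * a^2 * sin \<theta> * cos \<theta>) (at \<theta>)"
  unfolding gg_Sigma_def by (auto intro!: derivative_eq_intros simp: algebra_simps)

lemma D_deriv: "r \<in> I \<Longrightarrow> (D has_real_derivative 2 * r - F1 r) (at r)"
  unfolding D_def by (auto intro!: derivative_eq_intros F_deriv)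

lemmas field_derivs = S_deriv_r S_deriv_th D_deriv F_deriv F1_deriv

text \<open>The \<open>DERIV_cong\<close> copies leave the derivative open up to an equation, which
  is the shape of the rules in \<open>derivative_eq_intros\<close>.\<close>

lemmas derivs = field_derivs field_derivs[THEN DERIV_cong]

text \<open>Here \<open>q'\<close> is the r-derivative of F/Sigma, the combination through which F
  enters the (t, phi) block; in \<open>metric_th\<close> it is the theta-derivative.\<close>

definition metric_r :: "real \<Rightarrow> real \<Rightarrow> real^4^4" where
  "metric_r r \<theta> =
    (let q' = (F1 r - 2 * r * F r / S r \<theta>) / S r \<theta>; s = sin \<theta> in
     vector
    [vector [q', 0, 0, - a * s^2 * q'],
     vector [0, (2 * r * D r - S r \<theta> * (2 * r - F1 r)) / (D r)^2, 0, 0],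
     vector [0, 0, 2 * r, 0],
     vector [- a * s^2 * q', 0, 0, (2 * r + a^2 * s^2 * q') * s^2]])"

definition metric_th :: "real \<Rightarrow> real \<Rightarrow> real^4^4" where
  "metric_th r \<theta> =
    (let q = F r / S r \<theta>; s = sin \<theta>; c = cos \<theta>; q' = 2 * a^2 * s * c * q / S r \<theta> in
     vector
    [vector [q', 0, 0, - a * (2 * s * c * q + s^2 * q')],
     vector [0, - 2 * a^2 * s * c / D r, 0, 0],
     vector [0, 0, - 2 * a^2 * s * c, 0],
     vector [- a * (2 * s * c * q + s^2 * q'), 0, 0,
       2 * s * c * (r^2 + a^2) + a^2 * (4 * s^3 * c * q + s^4 * q')]])"

lemma metric_rt_deriv_r:
  assumes "r \<in> I" "S r \<theta> \<noteq> 0" "D r \<noteq> 0"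
  shows "((\<lambda>r. metric_rt r \<theta> $ i $ j) has_real_derivative metric_r r \<theta> $ i $ j) (at r)"
proof -
  have "\<forall>i j. ((\<lambda>r. metric_rt r \<theta> $ i $ j) has_real_derivative metric_r r \<theta> $ i $ j) (at r)"
    unfolding metric_rt_def metric_r_def Let_def forall_4 vector_4 using assms
    by (auto intro!: derivative_eq_intros derivs)
       (simp_all add: field_simps power2_eq_square)
  then show ?thesis by blast
qed

lemma metric_rt_deriv_th:
  assumes "S r \<theta> \<noteq> 0" "D r \<noteq> 0"
  shows "((\<lambda>\<theta>. metric_rt r \<theta> $ i $ j) has_real_derivative metric_th r \<theta> $ i $ j) (at \<theta>)"
proof -
  have "\<forall>i j. ((\<lambda>\<theta>. metric_rt r \<theta> $ i $ j) has_real_derivative metric_th r \<theta> $ i $ j) (at \<theta>)"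
    unfolding metric_rt_def metric_th_def Let_def forall_4 vector_4 using assms
    by (auto intro!: derivative_eq_intros derivs)
       (simp_all add: field_simps power2_eq_square power3_eq_cube power4_eq_xxxx)
  then show ?thesis by blast
qed

lemma matrix_inv_metric: "x \<in> U \<Longrightarrow> matrix_inv (g x) = inverse_rt (x$2) (x$3)"
  unfolding metric_eq by (rule matrix_inv_eqI, rule inverse_rt) (auto dest: chart_nonzero)

text \<open>Abbreviated symbols list the upper index first; the index \<open>h\<close> stands for $\theta$ and \<open>f\<close> for $\phi$.
  Only the factors \<open>i\<close>, \<open>j\<close>, \<open>k\<close> carry denominators, so that the Ricci tensor becomes
  polynomial in all variables, subject to \<open>d * j = 1\<close>, \<open>s * k = 1\<close> and the relations
  that define \<open>i\<close> and \<open>c\<close>.\<close>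

definition christoffel_rt :: "real \<Rightarrow> real \<Rightarrow> real^4^4^4" where
  "christoffel_rt r \<theta> =
    (let s = sin \<theta>; c = cos \<theta>; f = F r; d = D r;
       i = 1 / S r \<theta>; j = 1 / D r; k = 1 / sin \<theta>;
       p = F1 r - 2 * r * F r * i;
       t_tr = - (r^2 + a^2) * p * i * j / 2;
       t_th = - (a^2) * s * c * f * i^2;
       t_fr = a * s^2 * (p * (r^2 + a^2) * i - 2 * r * f * i) * j / 2;
       t_fh = a^3 * s^3 * c * f * i^2;
       f_tr = - a * p * i * j / 2;
       f_th = - a * f * c * k * i^2;
       f_fr = (2 * r * (1 - f * i) + a^2 * s^2 * p * i) * j / 2;
       f_fh = c * k + a^2 * s * c * f * i^2;
       r_tf = a * s^2 * d * p * i^2 / 2;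
       h_tf = a * s * c * f * (r^2 + a^2) * i^3;
       r_rh = - (a^2) * s * c * i
     in vector
    [vector [vector [0, t_tr, t_th, 0],
             vector [t_tr, 0, 0, t_fr],
             vector [t_th, 0, 0, t_fh],
             vector [0, t_fr, t_fh, 0]],
     vector [vector [- d * p * i^2 / 2, 0, 0, r_tf],
             vector [0, r * i - (2 * r - F1 r) * j / 2, r_rh, 0],
             vector [0, r_rh, - r * d * i, 0],
             vector [r_tf, 0, 0, - d * s^2 * (2 * r * i + a^2 * s^2 * p * i^2) / 2]],
     vector [vector [- (a^2) * s * c * f * i^3, 0, 0, h_tf],
             vector [0, a^2 * s * c * i * j, r * i, 0],
             vector [0, r * i, - (a^2) * s * c * i, 0],
             vector [h_tf, 0, 0, - s * c * ((r^2 + a^2) * i + a^2 * s^2 * f * (2 * i^2 + a^2 * s^2 * i^3))]],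
     vector [vector [0, f_tr, f_th, 0],
             vector [f_tr, 0, 0, f_fr],
             vector [f_th, 0, 0, f_fh],
             vector [0, f_fr, f_fh, 0]]])"

lemma partial_metric:
  assumes "x \<in> U"
  shows "partial 1 (\<lambda>y. g y $ i $ j) x = 0"
    "partial 2 (\<lambda>y. g y $ i $ j) x = metric_r (x$2) (x$3) $ i $ j"
    "partial 3 (\<lambda>y. g y $ i $ j) x = metric_th (x$2) (x$3) $ i $ j"
    "partial 4 (\<lambda>y. g y $ i $ j) x = 0"
  using chart_nonzero[OF assms] unfolding metric_eq
  by (auto intro!: partial_1_eqI[OF open_chart assms, where H = "\<lambda>r \<theta>. metric_rt r \<theta> $ i $ j"]
     partial_4_eqI[OF open_chart assms, where H = "\<lambda>r \<theta>. metric_rt r \<theta> $ i $ j"]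
     partial_2_eqI[OF open_chart assms, where H = "\<lambda>r \<theta>. metric_rt r \<theta> $ i $ j"]
     partial_3_eqI[OF open_chart assms, where H = "\<lambda>r \<theta>. metric_rt r \<theta> $ i $ j"]
     metric_rt_deriv_r metric_rt_deriv_th)

lemma christoffel_eq:
  assumes x: "x \<in> U"
  shows "christoffel g \<mu> \<nu> \<rho> x = christoffel_rt (x$2) (x$3) $ \<mu> $ \<nu> $ \<rho>"
proof -
  define \<Sigma> \<Delta> s where "\<Sigma> = S (x$2) (x$3)" and "\<Delta> = D (x$2)" and "s = sin (x$3)"
  have r: "(x$2)^2 + a^2 = \<Sigma> + a^2 * s^2"
    by (simp add: \<Sigma>_def s_def gg_Sigma_def cos_squared_eq algebra_simps)
  have F: "F (x$2) = \<Sigma> + a^2 * s^2 - \<Delta>"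
    using r by (simp add: \<Delta>_def D_def)
  have nz: "\<Sigma> \<noteq> 0" "\<Delta> \<noteq> 0" "s \<noteq> 0" using chart_nonzero[OF x] by (auto simp: \<Sigma>_def \<Delta>_def s_def)
  have "\<forall>\<mu> \<nu> \<rho>. christoffel g \<mu> \<nu> \<rho> x = christoffel_rt (x$2) (x$3) $ \<mu> $ \<nu> $ \<rho>"
    unfolding forall_4 christoffel_def sum_4 partial_metric[OF x] matrix_inv_metric[OF x]
      metric_r_def metric_th_def inverse_rt_def christoffel_rt_def Let_def vector_4 mult_zero_left mult_zero_right
      add_0_left add_0_right diff_zero diff_self
    unfolding \<Sigma>_def[symmetric] \<Delta>_def[symmetric] s_def[symmetric] r F
    using nz
    apply (intro conjI)
    apply (simp_all)
    apply (simp_all add: divide_simps)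
    apply algebra+
    done
  then show ?thesis by blast
qed

text \<open>These r-derivatives, up to symmetry of the lower indices, are those that occur in the
  six Ricci components computed below; the one of
  \<open>christoffel_rt r \<theta> $ 2 $ 2 $ 2\<close> cancels in R_rr. The quantity
  \<open>p\<close> is Sigma times the r-derivative of F/Sigma, and \<open>p'\<close>,
  \<open>d'\<close> are the r-derivatives of \<open>p\<close> and \<open>d\<close>.\<close>

lemma christoffel_rt_deriv_r:
  assumes nz: "r \<in> I" "S r \<theta> \<noteq> 0" "D r \<noteq> 0"
  defines "s \<equiv> sin \<theta>" and "i \<equiv> 1 / S r \<theta>" and "j \<equiv> 1 / D r" and "d \<equiv> D r"
  defines "p \<equiv> F1 r - 2 * r * F r * i" and "d' \<equiv> 2 * r - F1 r"
  defines "p' \<equiv> F2 r - 2 * F r * i - 2 * r * i * p"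
  shows
    "((\<lambda>r. christoffel_rt r \<theta> $ 2 $ 1 $ 1) has_real_derivative
        - (d' * p + d * p') * i^2 / 2 + 2 * r * d * p * i^3) (at r)" (is ?A)
    "((\<lambda>r. christoffel_rt r \<theta> $ 2 $ 1 $ 4) has_real_derivative
        a * s^2 * ((d' * p + d * p') * i^2 / 2 - 2 * r * d * p * i^3)) (at r)" (is ?B)
    "((\<lambda>r. christoffel_rt r \<theta> $ 2 $ 4 $ 4) has_real_derivative
        - d' * s^2 * (2 * r * i + a^2 * s^2 * p * i^2) / 2
        - d * s^2 * (2 * i - 4 * r^2 * i^2 + a^2 * s^2 * (p' * i^2 - 4 * r * p * i^3)) / 2) (at r)" (is ?C)
    "((\<lambda>r. christoffel_rt r \<theta> $ 2 $ 3 $ 3) has_real_derivative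
        - (d + r * d') * i + 2 * r^2 * d * i^2) (at r)" (is ?D)
    "((\<lambda>r. christoffel_rt r \<theta> $ 1 $ 1 $ 2) has_real_derivative
        - (2 * r * p + (r^2 + a^2) * p') * i * j / 2
        + (r^2 + a^2) * p * (2 * r * i^2 * j + i * j^2 * d') / 2) (at r)" (is ?E)
    "((\<lambda>r. christoffel_rt r \<theta> $ 3 $ 3 $ 2) has_real_derivative i - 2 * r^2 * i^2) (at r)" (is ?F)
    "((\<lambda>r. christoffel_rt r \<theta> $ 4 $ 4 $ 2) has_real_derivative
        (2 * (1 - F r * i) - 2 * r * (F1 r * i - 2 * r * F r * i^2)
           + a^2 * s^2 * (p' * i - 2 * r * p * i^2)) * j / 2
        - (2 * r * (1 - F r * i) + a^2 * s^2 * p * i) * j^2 * d' / 2) (at r)" (is ?G)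
proof -
  note defs = christoffel_rt_def Let_def vector_4 s_def i_def j_def d_def p_def p'_def d'_def
  show ?A unfolding defs using nz by (auto intro!: derivative_eq_intros derivs) (simp add: divide_simps; algebra)
  show ?B unfolding defs using nz by (auto intro!: derivative_eq_intros derivs) (simp add: divide_simps; algebra)
  show ?C unfolding defs using nz by (auto intro!: derivative_eq_intros derivs) (simp add: divide_simps; algebra)
  show ?D unfolding defs using nz by (auto intro!: derivative_eq_intros derivs) (simp add: divide_simps; algebra)
  show ?E unfolding defs using nz by (auto intro!: derivative_eq_intros derivs) (simp add: divide_simps; algebra)
  show ?F unfolding defs using nz by (auto intro!: derivative_eq_intros derivs) (simp add: divide_simps; algebra)
  show ?G unfolding defs using nz by (auto intro!: derivative_eq_intros derivs) (simp add: divide_simps; algebra)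
qed

lemma christoffel_rt_deriv_th:
  assumes nz: "S r \<theta> \<noteq> 0" "D r \<noteq> 0" "sin \<theta> \<noteq> 0"
  defines "s \<equiv> sin \<theta>" and "c \<equiv> cos \<theta>" and "i \<equiv> 1 / S r \<theta>" and "j \<equiv> 1 / D r" and "k \<equiv> 1 / sin \<theta>"
  shows
    "((\<lambda>\<theta>. christoffel_rt r \<theta> $ 3 $ 1 $ 1) has_real_derivative
        - (a^2) * F r * ((c^2 - s^2) * i^3 + 6 * a^2 * s^2 * c^2 * i^4)) (at \<theta>)" (is ?A)
    "((\<lambda>\<theta>. christoffel_rt r \<theta> $ 3 $ 1 $ 4) has_real_derivative
        a * F r * (r^2 + a^2) * ((c^2 - s^2) * i^3 + 6 * a^2 * s^2 * c^2 * i^4)) (at \<theta>)" (is ?B)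
    "((\<lambda>\<theta>. christoffel_rt r \<theta> $ 3 $ 4 $ 4) has_real_derivative
        - (r^2 + a^2) * ((c^2 - s^2) * i + 2 * a^2 * s^2 * c^2 * i^2)
        - a^2 * F r * ((3 * s^2 * c^2 - s^4) * (2 * i^2 + a^2 * s^2 * i^3) + 10 * a^2 * s^4 * c^2 * i^3
            + 6 * a^4 * s^6 * c^2 * i^4)) (at \<theta>)" (is ?C)
    "((\<lambda>\<theta>. christoffel_rt r \<theta> $ 3 $ 2 $ 2) has_real_derivative
        a^2 * j * ((c^2 - s^2) * i + 2 * a^2 * s^2 * c^2 * i^2)) (at \<theta>)" (is ?D)
    "((\<lambda>\<theta>. christoffel_rt r \<theta> $ 1 $ 1 $ 3) has_real_derivative
        - (a^2) * F r * ((c^2 - s^2) * i^2 + 4 * a^2 * s^2 * c^2 * i^3)) (at \<theta>)" (is ?E)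
    "((\<lambda>\<theta>. christoffel_rt r \<theta> $ 2 $ 2 $ 3) has_real_derivative
        - (a^2) * ((c^2 - s^2) * i + 2 * a^2 * s^2 * c^2 * i^2)) (at \<theta>)" (is ?F)
    "((\<lambda>\<theta>. christoffel_rt r \<theta> $ 4 $ 4 $ 3) has_real_derivative
        - (k^2) + a^2 * F r * ((c^2 - s^2) * i^2 + 4 * a^2 * s^2 * c^2 * i^3)) (at \<theta>)" (is ?G)
proof -
  note defs = christoffel_rt_def Let_def vector_4 s_def c_def i_def j_def k_def
  \<comment> \<open>Enters \<open>?G\<close>, where the derivative of cot is -(s^2 + c^2)/s^2 and
    has to become -(k^2).\<close>
  have c2: "cos \<theta> ^ 2 = 1 - sin \<theta> ^ 2" by (rule cos_squared_eq)
  show ?A unfolding defs using nz by (auto intro!: derivative_eq_intros derivs) (simp add: divide_simps; algebra)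
  show ?B unfolding defs using nz by (auto intro!: derivative_eq_intros derivs) (simp add: divide_simps; algebra)
  show ?C unfolding defs using nz by (auto intro!: derivative_eq_intros derivs) (simp add: divide_simps; algebra)
  show ?D unfolding defs using nz by (auto intro!: derivative_eq_intros derivs) (simp add: divide_simps; algebra)
  show ?E unfolding defs using nz by (auto intro!: derivative_eq_intros derivs) (simp add: divide_simps; algebra)
  show ?F unfolding defs using nz by (auto intro!: derivative_eq_intros derivs) (simp add: divide_simps; algebra)
  show ?G unfolding defs using nz c2 by (auto intro!: derivative_eq_intros derivs) (simp add: divide_simps; algebra)
qed

section \<open>Ricci curvature\<close>

lemma partial_christoffel:
  assumes "x \<in> U"
  shows "partial 1 (christoffel g \<mu> \<nu> \<rho>) x = 0"
    "partial 4 (christoffel g \<mu> \<nu> \<rho>) x = 0"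
    "((\<lambda>r. christoffel_rt r (x$3) $ \<mu> $ \<nu> $ \<rho>) has_real_derivative d) (at (x$2)) \<Longrightarrow>
      partial 2 (christoffel g \<mu> \<nu> \<rho>) x = d"
    "((\<lambda>\<theta>. christoffel_rt (x$2) \<theta> $ \<mu> $ \<nu> $ \<rho>) has_real_derivative d) (at (x$3)) \<Longrightarrow>
      partial 3 (christoffel g \<mu> \<nu> \<rho>) x = d"
  by (auto intro!: partial_1_eqI[OF open_chart assms, where H = "\<lambda>r \<theta>. christoffel_rt r \<theta> $ \<mu> $ \<nu> $ \<rho>"]
     partial_4_eqI[OF open_chart assms, where H = "\<lambda>r \<theta>. christoffel_rt r \<theta> $ \<mu> $ \<nu> $ \<rho>"]
     partial_2_eqI[OF open_chart assms, where H = "\<lambda>r \<theta>. christoffel_rt r \<theta> $ \<mu> $ \<nu> $ \<rho>"]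
     partial_3_eqI[OF open_chart assms, where H = "\<lambda>r \<theta>. christoffel_rt r \<theta> $ \<mu> $ \<nu> $ \<rho>"]
     christoffel_eq)

lemma christoffel_rt_sym: "christoffel_rt r \<theta> $ \<mu> $ \<nu> $ \<rho> = christoffel_rt r \<theta> $ \<mu> $ \<rho> $ \<nu>"
proof -
  have "\<forall>\<mu> \<nu> \<rho>. christoffel_rt r \<theta> $ \<mu> $ \<nu> $ \<rho> = christoffel_rt r \<theta> $ \<mu> $ \<rho> $ \<nu>"
    unfolding forall_4 christoffel_rt_def Let_def vector_4 by simp
  then show ?thesis by blast
qed

text \<open>These are the components that the nonzero entries of the inverse metric pick out. Sigma
  is to appear only through its reciprocal \<open>i\<close>: the (2, 2) equation is therefore
  multiplied by \<open>i\<close>, and in the (3, 3) equation L2 Sigma is written out with one factor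
  \<open>i\<close> cancelled.\<close>

lemma ricci_eq:
  assumes x: "x \<in> U"
  defines "s \<equiv> sin (x$3)" and "r \<equiv> x$2" and "d \<equiv> D (x$2)"
    and "i \<equiv> 1 / S (x$2) (x$3)" and "j \<equiv> 1 / D (x$2)"
  defines "L2 \<equiv> (r * F1 r - F r) * i^2"
  defines "L1 \<equiv> F2 r * i / 2 - L2"
  shows "ricci g 1 1 x = - L1 * d * i + L2 * s^2 * a^2 * i"
    "ricci g 1 4 x = L1 * d * a * s^2 * i - L2 * s^2 * a * (r^2 + a^2) * i"
    "ricci g 4 1 x = L1 * d * a * s^2 * i - L2 * s^2 * a * (r^2 + a^2) * i"
    "ricci g 4 4 x = - L1 * d * a^2 * s^4 * i + L2 * s^2 * (r^2 + a^2)^2 * i"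
    "i * ricci g 2 2 x = L1 * j"
    "ricci g 3 3 x = (r * F1 r - F r) * i"
proof -
  define c k where "c = cos (x$3)" and "k = 1 / sin (x$3)"
  have c2: "c^2 = 1 - s^2" by (simp add: c_def s_def cos_squared_eq)
  have d: "d = r^2 + a^2 - F r" by (simp add: d_def D_def r_def)
  have i: "i * (r^2 + a^2 * (1 - s^2)) = 1" and j: "d * j = 1" and k: "s * k = 1"
    using chart_nonzero[OF x]
    by (simp_all add: i_def j_def k_def d_def s_def r_def gg_Sigma_def cos_squared_eq)
  note dr = christoffel_rt_deriv_r[OF chart_nonzero(4,1,2)[OF x]]
  note dt = christoffel_rt_deriv_th[OF chart_nonzero(1,2,3)[OF x]]
  note partials = dr[THEN partial_christoffel(3)[OF x]] dt[THEN partial_christoffel(4)[OF x]]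
      \<comment> \<open>\<open>ricci g 1 4\<close> differentiates the symbols with lower indices 4
        1, \<open>ricci g 4 1\<close> those with 1 4; both orders are supplied.\<close>
      dr(2)[unfolded christoffel_rt_sym[of _ _ 2 1 4], THEN partial_christoffel(3)[OF x]]
      dt(2)[unfolded christoffel_rt_sym[of _ _ 3 1 4], THEN partial_christoffel(4)[OF x]]
  note ricci_unfold = ricci_def riemann_def sum_4 partial_christoffel(1,2)[OF x] partials
    christoffel_eq[OF x] christoffel_rt_def[of "x$2" "x$3"] Let_def vector_4 diff_self
    i_def[symmetric] j_def[symmetric] k_def[symmetric]
  note variables = s_def[symmetric] c_def[symmetric] d_def[symmetric] L1_def L2_def
  \<comment> \<open>With \<open>p\<close> in place of \<open>F1 r\<close> the Christoffel symbols
    are shorter, and so are the factors in the identities below.\<close>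
  define p where "p = F1 r - 2 * r * F r * i"
  have F1: "F1 r = p + 2 * r * F r * i" by (simp add: p_def)
  have di: "d * i = 1 + a^2 * s^2 * i - F r * i"
    using i by (simp add: d algebra_simps)
  \<comment> \<open>The relations in the form "polynomial = 0". The last two are the definitions of
    Delta and Sigma, multiplied by \<open>i\<close> to avoid Sigma itself.\<close>
  have zeros: "d * j - 1 = 0" "s * k - 1 = 0" "c^2 - (1 - s^2) = 0"
    "d * i - (1 + a^2 * s^2 * i - F r * i) = 0" "r^2 * i - (1 - a^2 * (1 - s^2) * i) = 0"
    using c2 i j k di by (simp_all add: algebra_simps)
  \<comment> \<open>Eliminating \<open>d\<close> between the relations for \<open>d * j\<close> and
    \<open>d * i\<close> gives one more relation, free of \<open>d\<close>, with which the (2, 2)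
    component is reduced.\<close>
  have "i * (d * j) = (d * i) * j" by simp
  then have "i = (1 + a^2 * s^2 * i - F r * i) * j" unfolding j di by simp
  then have zeros': "F r * i * j - (j + a^2 * s^2 * i * j - i) = 0"
    by (simp add: algebra_simps)
  \<comment> \<open>The factors of the vanishing terms come from dividing each difference by the relations.\<close>
  have "ricci g 1 1 x - (- L1 * d * i + L2 * s^2 * a^2 * i)
       = (- (1/4 * a^2 * i^3 * p^2) + 1/4 * a^2 * i^3 * p^2 * s^2 - 1/4 * i^2 * p^2 - 1/4 * i^3 * p^2 * r^2) * (d * j - 1)
         + (- (a^2 * c^2 * F r * i^3) + 2 * a^2 * c^2 * F r^2 * i^5 * r^2 + 2 * a^4 * c^2 * F r^2 * i^5) * (s * k - 1)
         + (- (2 * a^2 * F r * i^3) + 2 * a^2 * F r^2 * i^5 * r^2 - 4 * a^4 * F r * i^4 * s^2 + 2 * a^4 * F r^2 * i^5 - 2 * a^4 * F r^2 * i^5 * s^2) * (c^2 - (1 - s^2))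
         + (2 * F r * i^2 - 2 * F r * i^3 * r^2 + i^2 * p * r) * (d * i - (1 + a^2 * s^2 * i - F r * i))
         + (- (4 * a^2 * F r * i^3 * s^2) + 2 * a^2 * F r^2 * i^4 - 2 * a^2 * F r^2 * i^4 * s^2 - 2 * F r * i^2 + 2 * F r^2 * i^3 - 1/4 * i^2 * p^2) * (r^2 * i - (1 - a^2 * (1 - s^2) * i))"
    unfolding ricci_unfold unfolding variables unfolding r_def[symmetric] F1
    by (simp add: field_simps power2_eq_square power3_eq_cube eval_nat_numeral)
  then show "ricci g 1 1 x = - L1 * d * i + L2 * s^2 * a^2 * i"
    by (simp only: zeros zeros' mult_zero_right add_0_right right_minus_eq)
  have "ricci g 1 4 x - (L1 * d * a * s^2 * i - L2 * s^2 * a * (r^2 + a^2) * i)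
       = (- (a * i^2 * p * r * s^2) + 1/4 * a * i^2 * p^2 * s^2 + 1/4 * a * i^3 * p^2 * r^2 * s^2 + 1/4 * a^3 * i^3 * p^2 * s^2 - 1/4 * a^3 * i^3 * p^2 * s^4) * (d * j - 1)
         + (- (a * c^2 * F r * i^3 * r^2) - a^3 * c^2 * F r * i^3 - 2 * a^3 * c^2 * F r^2 * i^4 * s^2 - a^5 * c^2 * F r^2 * i^5 * s^4) * (s * k - 1)
         + (4 * a^3 * F r * i^4 * r^2 * s^2 - 2 * a^3 * F r^2 * i^4 * s^2 + 4 * a^5 * F r * i^4 * s^2) * (c^2 - (1 - s^2))
         + (- (2 * a * F r * i^2 * s^2) + 2 * a * F r * i^3 * r^2 * s^2 - a * i^2 * p * r * s^2) * (d * i - (1 + a^2 * s^2 * i - F r * i))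
         + (2 * a * F r * i^2 * s^2 + 2 * a * F r * i^3 * r^2 * s^2 - 2 * a * F r^2 * i^3 * s^2 + a * i^2 * p * r * s^2 + 1/4 * a * i^2 * p^2 * s^2 + 4 * a^3 * F r * i^3 * s^2) * (r^2 * i - (1 - a^2 * (1 - s^2) * i))" (is "_ = ?K")
    unfolding ricci_unfold unfolding variables unfolding r_def[symmetric] F1
    by (simp add: field_simps power2_eq_square power3_eq_cube eval_nat_numeral)
  then show "ricci g 1 4 x = L1 * d * a * s^2 * i - L2 * s^2 * a * (r^2 + a^2) * i"
    by (simp only: zeros zeros' mult_zero_right add_0_right right_minus_eq)
  have "ricci g 4 1 x - (L1 * d * a * s^2 * i - L2 * s^2 * a * (r^2 + a^2) * i) = ?K"
    unfolding ricci_unfold unfolding variables unfolding r_def[symmetric] F1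
    by (simp add: field_simps power2_eq_square power3_eq_cube eval_nat_numeral)
  then show "ricci g 4 1 x = L1 * d * a * s^2 * i - L2 * s^2 * a * (r^2 + a^2) * i"
    by (simp only: zeros zeros' mult_zero_right add_0_right right_minus_eq)
  have "ricci g 4 4 x - (- L1 * d * a^2 * s^4 * i + L2 * s^2 * (r^2 + a^2)^2 * i)
       = (1/2 * a^2 * i^2 * p * r * s^2 + 3/2 * a^2 * i^2 * p * r * s^4 - 1/4 * a^2 * i^2 * p^2 * s^4 - 1/4 * a^2 * i^3 * p^2 * r^2 * s^4 - 1/4 * a^4 * i^3 * p^2 * s^4 + 1/4 * a^4 * i^3 * p^2 * s^6 - 2 * F r * i^2 * r^2 * s^2 - 1/2 * i * p * r * s^2 + 2 * i * r^2 * s^2 + 1/2 * i^2 * p * r^3 * s^2) * (d * j - 1)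
         + (2 * a^2 * c^2 * F r * i^2 * s^2 + a^2 * c^2 * i + a^4 * c^2 * F r * i^3 * s^4 + c^2 * i * r^2) * (s * k - 1)
         + (- (4 * a^2 * F r * i^2 * s^2) + 2 * a^2 * F r * i^3 * r^2 * s^2 + 2 * a^4 * F r * i^3 * s^2 - 8 * a^4 * F r * i^3 * s^4 + 4 * a^4 * F r^2 * i^4 * s^4 - 2 * a^4 * F r^2 * i^5 * r^2 * s^4 - 4 * a^6 * F r * i^4 * s^6 - 2 * a^6 * F r^2 * i^5 * s^4 + 2 * a^6 * F r^2 * i^5 * s^6) * (c^2 - (1 - s^2))
         + (2 * a^2 * F r * i^2 * s^4 - 2 * a^2 * F r * i^3 * r^2 * s^4 + a^2 * i^2 * p * r * s^4 - s^2) * (d * i - (1 + a^2 * s^2 * i - F r * i))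
         + (3 * a^2 * F r * i^2 * s^2 - 7 * a^2 * F r * i^2 * s^4 - 2 * a^2 * F r * i^3 * r^2 * s^2 - 2 * a^2 * F r * i^3 * r^2 * s^4 + 2 * a^2 * F r^2 * i^3 * s^4 - a^2 * i^2 * p * r * s^2 - a^2 * i^2 * p * r * s^4 - 1/4 * a^2 * i^2 * p^2 * s^4 - 4 * a^4 * F r * i^3 * s^6 - 2 * a^4 * F r^2 * i^4 * s^4 + 2 * a^4 * F r^2 * i^4 * s^6 - F r * i * s^2 - F r * i^2 * r^2 * s^2 - 2 * F r * i^3 * r^4 * s^2 - 1/2 * i * p * r * s^2 - i^2 * p * r^3 * s^2 + s^2) * (r^2 * i - (1 - a^2 * (1 - s^2) * i))"
    unfolding ricci_unfold unfolding variables unfolding r_def[symmetric] F1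
    by (simp add: field_simps power2_eq_square power3_eq_cube eval_nat_numeral)
  then show "ricci g 4 4 x = - L1 * d * a^2 * s^4 * i + L2 * s^2 * (r^2 + a^2)^2 * i"
    by (simp only: zeros zeros' mult_zero_right add_0_right right_minus_eq)
  have "i * ricci g 2 2 x - (L1 * j)
       = (a^2 * c^2 * i^2 * j) * (s * k - 1)
         + (2 * a^2 * i^2 * j + 2 * a^4 * i^3 * j * s^2) * (c^2 - (1 - s^2))
         + (- (1/4 * a^2 * i^2 * j^2 * p^2) + 1/4 * a^2 * i^2 * j^2 * p^2 * s^2 + F r * i^2 * j + 1/2 * F r * i^2 * j^2 * p * r + 1/2 * F2 r * i * j - 1/2 * i * j^2 * p * r + 2 * i^2 - 5/2 * i^2 * j * p * r - 1/4 * i^2 * j^2 * p^2 * r^2) * (r^2 * i - (1 - a^2 * (1 - s^2) * i))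
         + (- (2 * a^2 * i^2) + 2 * a^2 * i^2 * s^2 + i + i * j * p * r) * (F r * i * j - (j + a^2 * s^2 * i * j - i))"
    unfolding ricci_unfold unfolding variables unfolding r_def[symmetric] F1
    by (simp add: field_simps power2_eq_square power3_eq_cube eval_nat_numeral)
  then show "i * ricci g 2 2 x = L1 * j"
    by (simp only: zeros zeros' mult_zero_right add_0_right right_minus_eq)
  have "ricci g 3 3 x - ((r * F1 r - F r) * i)
       = (1/2 * a^2 * i^2 * p * r - 1/2 * a^2 * i^2 * p * r * s^2 - 1/2 * i * p * r + 1/2 * i^2 * p * r^3) * (d * j - 1)
         + (- (2 * a^2 * c^2 * F r * i^2) - a^2 * c^2 * i + 2 * a^4 * c^2 * F r^2 * i^4 * s^2) * (s * k - 1)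
         + (- (2 * a^2 * F r * i^2) + 2 * a^4 * i^2 * s^2 - k^2) * (c^2 - (1 - s^2))
         + (- (1) + 2 * i * r^2) * (d * i - (1 + a^2 * s^2 * i - F r * i))
         + (2 * a^2 * i * s^2 - 2 * F r * i + 1/2 * i * p * r) * (r^2 * i - (1 - a^2 * (1 - s^2) * i))
         + (1 + k * s) * (s * k - 1)"
    unfolding ricci_unfold unfolding variables unfolding r_def[symmetric] F1
    by (simp add: field_simps power2_eq_square power3_eq_cube eval_nat_numeral)
  then show "ricci g 3 3 x = (r * F1 r - F r) * i"
    by (simp only: zeros zeros' mult_zero_right add_0_right right_minus_eq)
qed

text \<open>The trace takes L1 from r, L2 from theta and L1 + L2 from the (t, phi) block; in the sum
  the terms without F'' cancel.\<close>

lemma ricci_scalar_eq: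
  assumes x: "x \<in> U"
  shows "ricci_scalar g x = F2 (x$2) / S (x$2) (x$3)"
proof -
  define \<Sigma> \<Delta> r s where "\<Sigma> = S (x$2) (x$3)" and "\<Delta> = D (x$2)" and "r = x$2" and "s = sin (x$3)"
  have nz: "\<Sigma> \<noteq> 0" "\<Delta> \<noteq> 0" "s \<noteq> 0"
    using chart_nonzero[OF x] by (auto simp: \<Sigma>_def \<Delta>_def s_def)
  have ra: "r^2 + a^2 = \<Sigma> + a^2 * s^2"
    by (simp add: \<Sigma>_def s_def r_def gg_Sigma_def cos_squared_eq algebra_simps)
  have F: "F r = \<Sigma> + a^2 * s^2 - \<Delta>"
    using ra by (simp add: \<Delta>_def D_def r_def)
  define L2 where "L2 = (r * F1 r - F r) * (1 / \<Sigma>)^2"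
  define L1 where "L1 = F2 r * (1 / \<Sigma>) / 2 - L2"
  note ricci = ricci_eq[OF x, folded \<Sigma>_def \<Delta>_def r_def s_def, folded L2_def, folded L1_def, unfolded ra]
  have "ricci_scalar g x =
      - (r^2 + a^2 + a^2 * F r * s^2 / \<Sigma>) / \<Delta> * ricci g 1 1 x
      - a * F r / (\<Sigma> * \<Delta>) * (ricci g 1 4 x + ricci g 4 1 x)
      + (1 - F r / \<Sigma>) / (\<Delta> * s^2) * ricci g 4 4 x
      + (\<Delta> * (1 / \<Sigma> * ricci g 2 2 x) + ricci g 3 3 x / \<Sigma>)"
    unfolding ricci_scalar_def sum_4 matrix_inv_metric[OF x] inverse_rt_def vector_4 \<Sigma>_def \<Delta>_def r_def s_def
    by (simp add: algebra_simps add_divide_distrib)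
  also have "\<Delta> * (1 / \<Sigma> * ricci g 2 2 x) = L1"
    unfolding ricci using nz by simp
  also have "ricci g 3 3 x / \<Sigma> = L2"
    unfolding ricci L2_def by (simp add: power2_eq_square)
  also have "- (r^2 + a^2 + a^2 * F r * s^2 / \<Sigma>) / \<Delta> * ricci g 1 1 x
      - a * F r / (\<Sigma> * \<Delta>) * (ricci g 1 4 x + ricci g 4 1 x)
      + (1 - F r / \<Sigma>) / (\<Delta> * s^2) * ricci g 4 4 x = L1 + L2"
    unfolding ricci ra F using nz
    by (simp add: divide_simps; algebra)
  also have "L1 + L2 + (L1 + L2) = F2 r / \<Sigma>"
    by (simp add: L1_def)
  finally show ?thesis by (simp add: r_def \<Sigma>_def)
qed

lemma metric_inverse: "x \<in> U \<Longrightarrow> g x ** matrix_inv (g x) = mat 1"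
  using inverse_rt[of "x$2" "x$3"] chart_nonzero[of x] matrix_inv_metric[of x] metric_eq[of x] by simp

lemma transpose_metric: "transpose (g x) = g x"
  by (simp add: metric_eq metric_rt_def transpose_def vec_eq_iff forall_4 vector_4)

end

section \<open>The Ricci scalar as a scalar polynomial\<close>

text \<open>The functions in the index set are \<open>undefined\<close> from 4 on, whereas
  \<open>(!) [a, b, c, d]\<close> is not controlled there; hence the assumption that
  \<open>f\<close> sees only the first four values.\<close>

lemma sum_PiE_4:
  fixes f :: "(nat \<Rightarrow> 'a::finite) \<Rightarrow> real"
  assumes "\<And>h k. (\<And>n. n < 4 \<Longrightarrow> h n = k n) \<Longrightarrow> f h = f k"
  shows "(\<Sum>h \<in> {..<4} \<rightarrow>\<^sub>E UNIV. f h) = (\<Sum>a\<in>UNIV. \<Sum>b\<in>UNIV. \<Sum>c\<in>UNIV. \<Sum>d\<in>UNIV. f ((!) [a, b, c, d]))"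
proof -
  have lt4: "k = 0 \<or> k = 1 \<or> k = 2 \<or> k = 3" if "k < 4" for k :: nat using that by auto
  have "(\<Sum>h \<in> {..<4} \<rightarrow>\<^sub>E UNIV. f h) = (\<Sum>(a, b, c, d) \<in> UNIV. f ((!) [a, b, c, d]))"
    by (rule sum.reindex_bij_witness[where i = "\<lambda>(a, b, c, d). restrict ((!) [a, b, c, d]) {..<4}"
          and j = "\<lambda>h. (h 0, h 1, h 2, h 3)"])
       (auto simp: fun_eq_iff PiE_def extensional_def dest!: lt4 intro!: assms)
  also have "\<dots> = (\<Sum>a\<in>UNIV. \<Sum>b\<in>UNIV. \<Sum>c\<in>UNIV. \<Sum>d\<in>UNIV. f ((!) [a, b, c, d]))"
    by (simp add: sum.cartesian_product UNIV_Times_UNIV[symmetric] del: UNIV_Times_UNIV)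
  finally show ?thesis .
qed

lemma transpose_matrix_inv:
  fixes A :: "real^'n^'n"
  assumes "A ** matrix_inv A = mat 1" "transpose A = A"
  shows "transpose (matrix_inv A) = matrix_inv A"
proof -
  have "transpose (matrix_inv A) ** A = mat 1"
    using arg_cong[OF assms(1), of transpose] assms(2) by (simp add: matrix_transpose_mul)
  then have "A ** transpose (matrix_inv A) = mat 1"
    by (rule matrix_left_right_inverse[THEN iffD1])
  then show ?thesis using matrix_inv_eqI by metis
qed

text \<open>Swapping slots 1 and 2 makes the pairs (0, 2) and (1, 3): the first inverse metric
  contracts the Riemann tensor to the Ricci tensor, the second takes its trace. Symmetry of the
  metric is used because slot 0 is the first index of both the metric and its inverse.\<close>

lemma complete_contraction_eq_ricci_scalar:
  fixes g :: "'n::finite metric"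
  assumes inv: "g x ** matrix_inv (g x) = mat 1" and sym: "transpose (g x) = g x"
  shows "complete_contraction g 1 (Transposition.transpose 1 2) x = ricci_scalar g x"
proof -
  define A where "A = matrix_inv (g x)"
  have "A ** g x = mat 1"
    using inv unfolding A_def by (rule matrix_left_right_inverse[THEN iffD1])
  moreover have "transpose A = A" unfolding A_def by (rule transpose_matrix_inv[OF inv sym])
  then have A_sym: "A $ i $ j = A $ j $ i" for i j by (metis transpose_def vec_lambda_beta)
  ultimately have delta: "(\<Sum>i\<in>UNIV. A $ i $ j * g x $ i $ k) = (if j = k then 1 else 0)" for j k
  proof -
    have "(\<Sum>i\<in>UNIV. A $ i $ j * g x $ i $ k) = (A ** g x) $ j $ k"
      by (simp add: matrix_matrix_mult_def A_sym[of _ j])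
    then show ?thesis using \<open>A ** g x = mat 1\<close> by (simp add: mat_def)
  qed
  have contraction: "complete_contraction g 1 (Transposition.transpose 1 2) x =
      (\<Sum>h \<in> {..<4::nat} \<rightarrow>\<^sub>E UNIV. riemann_low g (h 0) (h 1) (h 2) (h 3) x * (A $ h 0 $ h 2 * A $ h 1 $ h 3))"
    unfolding complete_contraction_def A_def[symmetric]
    by (simp add: Transposition.transpose_def numeral_2_eq_2 numeral_3_eq_3 lessThan_Suc mult.commute)
  have "complete_contraction g 1 (Transposition.transpose 1 2) x =
      (\<Sum>a\<in>UNIV. \<Sum>b\<in>UNIV. \<Sum>c\<in>UNIV. \<Sum>d\<in>UNIV. riemann_low g a b c d x * (A $ a $ c * A $ b $ d))"
    unfolding contraction by (subst sum_PiE_4) simp_all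
  also have "\<dots> = (\<Sum>b\<in>UNIV. \<Sum>d\<in>UNIV. A $ b $ d * (\<Sum>c\<in>UNIV. \<Sum>e\<in>UNIV.
      (\<Sum>a\<in>UNIV. A $ a $ c * g x $ a $ e) * riemann g e b c d x))"
    unfolding riemann_low_def sum_distrib_left sum_distrib_right sum.cartesian_product UNIV_Times_UNIV
    by (rule sum.reindex_bij_witness[where i = "\<lambda>(b, d, c, e, a). (a, b, c, d, e)"
          and j = "\<lambda>(a, b, c, d, e). (b, d, c, e, a)"]) (auto simp: mult_ac)
  also have "\<dots> = ricci_scalar g x"
    unfolding delta ricci_scalar_def ricci_def A_def[symmetric]
    by (simp add: if_distrib if_distribR cong: if_cong)
  finally show ?thesis .
qed

lemma transposed_contraction_in_scalar_polynomials:
  "complete_contraction g 1 (Transposition.transpose 1 2) \<in> scalar_polynomials g"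
  by (intro scalar_polynomials.contraction permutes_swap_id) auto

section \<open>Blow-up at a pole of the mass function\<close>

lemma islimpt_curve:
  fixes \<gamma> :: "real \<Rightarrow> 'a::t2_space"
  assumes "(\<gamma> \<longlongrightarrow> p) (at_right 0)" "\<forall>\<^sub>F t in at_right 0. \<gamma> t \<in> A \<and> \<gamma> t \<noteq> p"
  shows "p islimpt A"
  unfolding islimpt_def
proof (intro allI impI)
  fix T assume "p \<in> T" "open T"
  then have "\<forall>\<^sub>F t in at_right 0. \<gamma> t \<in> T" using assms(1) by (auto simp: tendsto_def)
  with assms(2) have "\<forall>\<^sub>F t in at_right 0. \<gamma> t \<in> A \<and> \<gamma> t \<in> T \<and> \<gamma> t \<noteq> p"
    by eventually_elim auto
  then show "\<exists>y\<in>A. y \<in> T \<and> y \<noteq> p"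
    using eventually_happens'[OF trivial_limit_at_right_real] by blast
qed

lemma segment_subset_extended_radii:
  assumes "r0 \<noteq> 0" "0 < t" "t < 1"
  shows "(1 - t) * r0 \<in> extended_radii (- {r0})"
proof -
  \<comment> \<open>Parameter 1 gives the base point 0 of the component; parameter 0, which would
    give \<open>r0\<close>, is left out.\<close>
  have "connected ((\<lambda>t. (1 - t) * r0) ` {0<..1})"
    by (intro connected_continuous_image continuous_intros) simp
  then have "(\<lambda>t. (1 - t) * r0) ` {0<..1} \<subseteq> connected_component_set (- {r0}) 0"
    by (rule connected_component_maximal[rotated]) (use assms in \<open>auto intro: image_eqI[of _ _ 1]\<close>)
  moreover have "(1 - t) * r0 \<in> (\<lambda>t. (1 - t) * r0) ` {0<..1}" using assms by simp
  ultimately show ?thesis unfolding extended_radii_def by blast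
qed

locale gurses_gursey_pole = gurses_gursey M F F1 F2 a "- {r0}" for M F F1 F2 a r0 +
  assumes r0: "r0 \<noteq> 0"
    and F_pole: "filterlim F at_infinity (at r0)"
    and F2_pole: "filterlim F2 at_infinity (at r0)"
begin

lemma eventually_Delta_nonzero: "\<forall>\<^sub>F r in at r0. gg_Delta M a r \<noteq> 0"
proof -
  have "((\<lambda>r. - (r^2 + a^2)) \<longlongrightarrow> - (r0^2 + a^2)) (at r0)" by (intro tendsto_intros)
  then have "filterlim (\<lambda>r. - (r^2 + a^2) + F r) at_infinity (at r0)"
    using F_pole by (rule tendsto_add_filterlim_at_infinity)
  then have "\<forall>\<^sub>F r in at r0. - (r^2 + a^2) + F r \<noteq> 0"
    using eventually_not_equal_at_infinity[of 0] by (auto simp: filterlim_iff)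
  then show ?thesis
    by eventually_elim (simp add: Delta_eq D_def)
qed

lemma radius_locus_islimpt:
  assumes p: "p \<in> radius_locus r0"
  shows "p islimpt gg_chart M a (extended_radii (- {r0}))"
proof -
  \<comment> \<open>The radius moves towards 0 and theta towards the equator, so the curve enters 0
    < theta < pi even when it starts on the axis. Sigma stays positive as long as the radius is
    nonzero.\<close>
  define v :: "real^4" where "v = axis 2 (- r0) + axis 3 (pi / 2 - p$3)"
  define \<gamma> where "\<gamma> t = p + t *\<^sub>R v" for t
  have \<gamma>: "\<gamma> t $ 2 = (1 - t) * r0" "\<gamma> t $ 3 = (1 - t) * p$3 + t * (pi / 2)" for t
    using p by (auto simp: \<gamma>_def v_def axis_def radius_locus_def algebra_simps)
  have "(\<gamma> \<longlongrightarrow> p + 0 *\<^sub>R v) (at_right 0)"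
    unfolding \<gamma>_def by (intro tendsto_intros)
  moreover have "\<forall>\<^sub>F t in at_right 0. \<gamma> t \<in> gg_chart M a (extended_radii (- {r0})) \<and> \<gamma> t \<noteq> p"
  proof -
    have "((\<lambda>t. (1 - t) * r0) \<longlongrightarrow> (1 - 0) * r0) (at_right 0)" by (intro tendsto_intros)
    moreover have "\<forall>\<^sub>F t in at_right 0. (1 - t) * r0 \<noteq> r0"
      using eventually_at_right_less[of "0::real"] by eventually_elim (use r0 in simp)
    ultimately have "filterlim (\<lambda>t. (1 - t) * r0) (at r0) (at_right 0)"
      by (simp add: filterlim_at)
    then have "\<forall>\<^sub>F t in at_right 0. gg_Delta M a ((1 - t) * r0) \<noteq> 0"
      using eventually_Delta_nonzero unfolding filterlim_iff by blast
    moreover have "\<forall>\<^sub>F t in at_right (0::real). 0 < t \<and> t < 1"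
      using eventually_at_right_real[of 0 "1::real"] by simp
    ultimately show ?thesis
    proof eventually_elim
      case (elim t)
      have "p$3 \<ge> 0" "p$3 \<le> pi" using p by (auto simp: radius_locus_def)
      then have "(1 - t) * p$3 \<ge> 0" "(1 - t) * p$3 \<le> (1 - t) * pi" "t * (pi/2) > 0" "t * (pi/2) < t * pi"
        using elim by (auto intro: mult_left_mono)
      moreover have "(1 - t) * pi + t * pi = pi" by (simp add: algebra_simps)
      ultimately have th: "0 < \<gamma> t $ 3" "\<gamma> t $ 3 < pi"
        unfolding \<gamma> by linarith+
      have "\<gamma> t $ 2 \<noteq> p $ 2"
        using elim r0 p by (auto simp: \<gamma> radius_locus_def)
      moreover have "S (\<gamma> t $ 2) (\<gamma> t $ 3) > 0"
        using elim r0 by (auto simp: \<gamma>(1) gg_Sigma_def intro!: add_pos_nonneg)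
      ultimately show ?case
        using elim th segment_subset_extended_radii[OF r0, of t] by (auto simp: gg_chart_def \<gamma>(1))
    qed
  qed
  ultimately show ?thesis by (intro islimpt_curve[of \<gamma>]) auto
qed

text \<open>Stated for any \<open>J\<close> between the component of 0 and all regular radii, and
  for any \<open>R\<close> that agrees with the Ricci scalar on the chart: it then serves both the
  Ricci scalar on the full chart and the complete contraction on the extended one.\<close>

lemma blows_up:
  assumes p: "p \<in> radius_locus r0" and R: "\<And>x. x \<in> U \<Longrightarrow> R x = ricci_scalar g x"
    and J: "extended_radii (- {r0}) \<subseteq> J" "J \<subseteq> - {r0}"
  shows "blows_up_at R (gg_chart M a J) p"
  unfolding blows_up_at_def
proof
  show "p islimpt gg_chart M a J"
    by (rule islimpt_subset[OF radius_locus_islimpt[OF p]]) (use J in \<open>auto simp: gg_chart_def\<close>)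
  let ?F = "at p within gg_chart M a J"
  have ev: "\<forall>\<^sub>F x in ?F. x \<in> gg_chart M a J" by (simp add: eventually_at_filter)
  then have U: "\<forall>\<^sub>F x in ?F. x \<in> U"
    by eventually_elim (use J in \<open>auto simp: gg_chart_def\<close>)
  have "((\<lambda>x. x$2) \<longlongrightarrow> p$2) ?F" by (intro tendsto_intros)
  moreover have "p$2 = r0" using p by (simp add: radius_locus_def)
  moreover have "\<forall>\<^sub>F x in ?F. x$2 \<noteq> r0"
    using U by eventually_elim (auto simp: gg_chart_def)
  ultimately have "filterlim (\<lambda>x. x$2) (at r0) ?F" by (simp add: filterlim_at)
  from filterlim_compose[OF filterlim_at_infinity_imp_norm_at_top[OF F2_pole] this]
  have F2: "filterlim (\<lambda>x. \<bar>F2 (x$2)\<bar>) at_top ?F" by simp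
  \<comment> \<open>Sigma is at least \<open>r0^2 > 0\<close> on the whole locus, the equator
    included.\<close>
  have "((\<lambda>x. 1 / S (x$2) (x$3)) \<longlongrightarrow> 1 / S (p$2) (p$3)) ?F" and "0 < 1 / S (p$2) (p$3)"
    using r0 \<open>p$2 = r0\<close> unfolding gg_Sigma_def
    by (auto intro!: tendsto_intros add_pos_nonneg simp: add_nonneg_eq_0_iff)
  from filterlim_at_top_mult_tendsto_pos[OF this F2]
  have lim: "filterlim (\<lambda>x. \<bar>F2 (x$2)\<bar> * (1 / S (x$2) (x$3))) at_top ?F" .
  have eq: "\<forall>\<^sub>F x in ?F. \<bar>F2 (x$2)\<bar> * (1 / S (x$2) (x$3)) = \<bar>R x\<bar>"
    using U by eventually_elim (simp add: R ricci_scalar_eq gg_Sigma_def abs_divide)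
  from lim show "filterlim (\<lambda>x. \<bar>R x\<bar>) at_top ?F"
    by (rule filterlim_cong[OF refl refl eq, THEN iffD1])
qed

lemma scalar_polynomial_singularity:
  "scalar_polynomial_singularity g (gg_chart M a (extended_radii (- {r0}))) (radius_locus r0)"
  unfolding scalar_polynomial_singularity_def
proof (intro conjI bexI ballI)
  have "vector [0, r0, 0, 0] \<in> radius_locus r0" by (simp add: radius_locus_def vector_4)
  then show "radius_locus r0 \<noteq> {}" by blast
  fix p assume "p \<in> radius_locus r0"
  then show "blows_up_at (complete_contraction g 1 (Transposition.transpose 1 2))
      (gg_chart M a (extended_radii (- {r0}))) p"
    using connected_component_subset
    by (intro blows_up complete_contraction_eq_ricci_scalar metric_inverse transpose_metric)
       (auto simp: extended_radii_def)
qed (rule transposed_contraction_in_scalar_polynomials)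

end

section \<open>The Fan-Wang and Hayward mass functions\<close>

lemma filterlim_quotient_at_infinity:
  fixes f h :: "real \<Rightarrow> real"
  assumes "isCont f p" "isCont h p" "f p \<noteq> 0" "h p = 0" "\<And>x. x \<noteq> p \<Longrightarrow> h x \<noteq> 0"
  shows "filterlim (\<lambda>x. f x / h x) at_infinity (at p)"
proof (rule filterlim_divide_at_infinity)
  show "(f \<longlongrightarrow> f p) (at p)" using assms(1) by (simp add: isCont_def)
  have "(h \<longlongrightarrow> 0) (at p)" using assms(2,4) by (simp add: isCont_def)
  moreover have "\<forall>\<^sub>F x in at p. h x \<noteq> 0"
    unfolding eventually_at_filter using assms(5) by (intro always_eventually) auto
  ultimately show "filterlim h (at 0) (at p)" by (simp add: filterlim_at)
qed (rule assms(3))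

lemma fan_wang_pole:
  assumes "m \<noteq> 0" "l > 0"
  shows "gurses_gursey_pole (fan_wang_mass m l) (\<lambda>r. 2 * m * r^4 / (r + l)^3)
    (\<lambda>r. 2 * m * r^3 * (r + 4 * l) / (r + l)^4) (\<lambda>r. 24 * m * l^2 * r^2 / (r + l)^5) (- l)"
proof
  show "open (- {- l})" by (rule open_Compl) simp
  \<comment> \<open>At \<open>r = - l\<close> both sides are 0, since division by zero yields
    0.\<close>
  show "2 * m * r^4 / (r + l)^3 = 2 * r * fan_wang_mass m l r" for r
    by (simp add: fan_wang_mass_def eval_nat_numeral)
  fix r assume "r \<in> - {- l}"
  then have nz: "r + l \<noteq> 0" by auto
  show "((\<lambda>r. 2 * m * r^4 / (r + l)^3) has_real_derivative 2 * m * r^3 * (r + 4 * l) / (r + l)^4) (at r)"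
    using nz by (auto intro!: derivative_eq_intros) (simp add: divide_simps; algebra)
  show "((\<lambda>r. 2 * m * r^3 * (r + 4 * l) / (r + l)^4) has_real_derivative 24 * m * l^2 * r^2 / (r + l)^5) (at r)"
    using nz by (auto intro!: derivative_eq_intros) (simp add: divide_simps; algebra)
next
  show "- l \<noteq> 0" using assms by simp
  show "filterlim (\<lambda>r. 2 * m * r^4 / (r + l)^3) at_infinity (at (- l))"
    by (rule filterlim_quotient_at_infinity) (use assms in \<open>auto intro!: continuous_intros\<close>)
  show "filterlim (\<lambda>r. 24 * m * l^2 * r^2 / (r + l)^5) at_infinity (at (- l))"
    by (rule filterlim_quotient_at_infinity) (use assms in \<open>auto intro!: continuous_intros\<close>)
qed

lemma hayward_pole:
  assumes "m \<noteq> 0" "l > 0" and r0: "\<And>r. r^3 + 2 * m * l^2 = 0 \<longleftrightarrow> r = r0"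
  shows "gurses_gursey_pole (hayward_mass m l) (\<lambda>r. 2 * m * r^4 / (r^3 + 2 * m * l^2))
    (\<lambda>r. 2 * m * (r^6 + 8 * m * l^2 * r^3) / (r^3 + 2 * m * l^2)^2)
    (\<lambda>r. - (24 * m^2 * l^2 * r^2 * (r^3 - 4 * m * l^2) / (r^3 + 2 * m * l^2)^3)) r0"
proof
  have r0_cube: "r0^3 = - (2 * m * l^2)" using r0[of r0] by simp
  show r0_nonzero: "r0 \<noteq> 0" using r0_cube assms(1,2) by auto
  show "open (- {r0})" by (rule open_Compl) simp
  show "2 * m * r^4 / (r^3 + 2 * m * l^2) = 2 * r * hayward_mass m l r" for r
    by (simp add: hayward_mass_def eval_nat_numeral)
  show "filterlim (\<lambda>r. 2 * m * r^4 / (r^3 + 2 * m * l^2)) at_infinity (at r0)"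
    by (rule filterlim_quotient_at_infinity)
       (use assms(1) r0_nonzero r0_cube in \<open>auto simp: r0 intro!: continuous_intros\<close>)
  \<comment> \<open>The zero of the numerator does not cancel the pole: at \<open>r0\<close> the
    factor \<open>r^3 - 4 * m * l^2\<close> equals \<open>- 6 * m * l^2\<close>.\<close>
  have "filterlim (\<lambda>r. - (24 * m^2 * l^2 * r^2 * (r^3 - 4 * m * l^2)) / (r^3 + 2 * m * l^2)^3)
      at_infinity (at r0)"
    by (rule filterlim_quotient_at_infinity)
       (use assms(1,2) r0_nonzero r0_cube in \<open>auto simp: r0 intro!: continuous_intros\<close>)
  then show "filterlim (\<lambda>r. - (24 * m^2 * l^2 * r^2 * (r^3 - 4 * m * l^2) / (r^3 + 2 * m * l^2)^3))
      at_infinity (at r0)"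
    by simp
  fix r assume "r \<in> - {r0}"
  then have nz: "r^3 + 2 * m * l^2 \<noteq> 0" using r0 by auto
  show "((\<lambda>r. 2 * m * r^4 / (r^3 + 2 * m * l^2)) has_real_derivative
      2 * m * (r^6 + 8 * m * l^2 * r^3) / (r^3 + 2 * m * l^2)^2) (at r)"
    using nz by (auto intro!: derivative_eq_intros) (simp add: divide_simps; algebra)
  show "((\<lambda>r. 2 * m * (r^6 + 8 * m * l^2 * r^3) / (r^3 + 2 * m * l^2)^2) has_real_derivative
      - (24 * m^2 * l^2 * r^2 * (r^3 - 4 * m * l^2) / (r^3 + 2 * m * l^2)^3)) (at r)"
    using nz by (auto intro!: derivative_eq_intros) (simp add: divide_simps; algebra)
qed

text \<open>The real cube root is odd, so both signs of \<open>m\<close> give the cube root of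
  \<open>- (2 * m * l^2)\<close>, and cubing is injective on the reals.\<close>

lemma hayward_root:
  fixes m l :: real
  shows "r^3 + 2 * m * l^2 = 0 \<longleftrightarrow> r = - sgn m * root 3 (2 * \<bar>m\<bar> * l^2)"
proof -
  have "- sgn m * root 3 (2 * \<bar>m\<bar> * l^2) = root 3 (- (2 * m * l^2))"
    by (cases m "0 :: real" rule: linorder_cases) (auto simp: real_root_minus[symmetric])
  moreover have "r^3 = y \<longleftrightarrow> r = root 3 y" for y
    by (metis odd_real_root_pow odd_real_root_power_cancel odd_numeral)
  ultimately show ?thesis by (metis eq_neg_iff_add_eq_0)
qed

theorem mainTheorem4:
  fixes m l a :: real
  assumes "a \<noteq> 0" and "m \<noteq> 0" and "l > 0"
  shows
    "(\<forall>x \<in> gg_chart (fan_wang_mass m l) a (fan_wang_radii l).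
        ricci_scalar (gg_metric (fan_wang_mass m l) a) x =
          24 * m * l^2 * (x$2)^2 / ((x$2 + l)^5 * ((x$2)^2 + a^2 * (cos (x$3))^2))) \<and>
     (\<forall>p \<in> radius_locus (- l).
        blows_up_at (ricci_scalar (gg_metric (fan_wang_mass m l) a))
          (gg_chart (fan_wang_mass m l) a (fan_wang_radii l)) p) \<and>
     (scalar_polynomial_singularity (gg_metric (fan_wang_mass m l) a)
        (gg_chart (fan_wang_mass m l) a (extended_radii (fan_wang_radii l)))
        (radius_locus (- l))) \<and>
     (radius_locus (- l) \<subseteq> {x. x$2 < 0}) \<and>
     (\<forall>x \<in> gg_chart (hayward_mass m l) a (hayward_radii m l).
        ricci_scalar (gg_metric (hayward_mass m l) a) x =
          - (24 * m^2 * l^2 * (x$2)^2 * ((x$2)^3 - 4 * m * l^2)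
             / (((x$2)^3 + 2 * m * l^2)^3 * ((x$2)^2 + a^2 * (cos (x$3))^2)))) \<and>
     (\<forall>p \<in> radius_locus (- sgn m * root 3 (2 * \<bar>m\<bar> * l^2)).
        blows_up_at (ricci_scalar (gg_metric (hayward_mass m l) a))
          (gg_chart (hayward_mass m l) a (hayward_radii m l)) p) \<and>
     (scalar_polynomial_singularity (gg_metric (hayward_mass m l) a)
        (gg_chart (hayward_mass m l) a (extended_radii (hayward_radii m l)))
        (radius_locus (- sgn m * root 3 (2 * \<bar>m\<bar> * l^2)))) \<and>
     (m > 0 \<longrightarrow>
        radius_locus (- sgn m * root 3 (2 * \<bar>m\<bar> * l^2)) \<subseteq> {x. x$2 < 0}) \<and>
     (m < 0 \<longrightarrow>
        radius_locus (- sgn m * root 3 (2 * \<bar>m\<bar> * l^2)) \<subseteq> {x. x$2 > 0})"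
proof -
  define rH where "rH = - sgn m * root 3 (2 * \<bar>m\<bar> * l^2)"
  interpret fw: gurses_gursey_pole "fan_wang_mass m l" "\<lambda>r. 2 * m * r^4 / (r + l)^3"
    "\<lambda>r. 2 * m * r^3 * (r + 4 * l) / (r + l)^4" "\<lambda>r. 24 * m * l^2 * r^2 / (r + l)^5" a "- l"
    using assms by (intro fan_wang_pole)
  interpret hw: gurses_gursey_pole "hayward_mass m l" "\<lambda>r. 2 * m * r^4 / (r^3 + 2 * m * l^2)"
    "\<lambda>r. 2 * m * (r^6 + 8 * m * l^2 * r^3) / (r^3 + 2 * m * l^2)^2"
    "\<lambda>r. - (24 * m^2 * l^2 * r^2 * (r^3 - 4 * m * l^2) / (r^3 + 2 * m * l^2)^3)" a rH
    using assms by (intro hayward_pole) (simp_all add: rH_def hayward_root)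
  have fw_radii: "fan_wang_radii l = - {- l}"
    by (auto simp: fan_wang_radii_def)
  have hw_radii: "hayward_radii m l = - {rH}"
    by (auto simp: hayward_radii_def rH_def hayward_root)
  have extended: "extended_radii I \<subseteq> I" for I
    by (auto simp: extended_radii_def dest: connected_component_in)
  have "0 < root 3 (2 * \<bar>m\<bar> * l^2)"
    using assms by simp
  \<comment> \<open>The sign of \<open>m\<close> decides on which side of r = 0 the Hayward pole
    lies: at negative r for positive mass, at positive r for negative mass.\<close>
  then have sign: "0 < m \<Longrightarrow> rH < 0" "m < 0 \<Longrightarrow> 0 < rH"
    by (simp_all add: rH_def)
  show ?thesis
    unfolding rH_def[symmetric] fw_radii hw_radii
    using fw.scalar_polynomial_singularity hw.scalar_polynomial_singularity sign assms(3)
    by (intro conjI ballI impI fw.blows_up hw.blows_up extended order_refl)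
       (auto simp: fw.ricci_scalar_eq hw.ricci_scalar_eq gg_Sigma_def radius_locus_def)
qed

end
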